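(* Let $P=\langle A,S,s_0,T\rangle$ be a well-behaved GSP process, and let $s\in S$ be such that all paths from $s_0$ to $s$ in $P$ are free. Then reachability of $s$ is synchronization-independent in $P$; that is, for every $m\in\mathbb{N}$, $c=m$ is a cutoff for $\phi_m(s)$: $$\bigl(\exists n\in\mathbb{N}:\ \mathcal{M}(n)\models\phi_m(s)\bigr)\iff\mathcal{M}(m)\models\phi_m(s).$$
   Context: **Guarded process.** A (guarded) GSP process is $P=\langle A,S,s_0,T\rangle$ with $S$ a finite set of local states, $s_0\in S$ initial, $T\subseteq S\times A\times\mathcal{P}(S)\times S$; the subset of $S$ labelling a transition is its guard. $A$ is built from a finite set $\mathcal{A}$ of global actions; each $a\in\mathcal{A}$ has an arity $k\ge1$ and is either a *$k$-sender action* or a *$k$-maximal action*. Each $a$ contributes local sending actions $a_1!!,\dots,a_k!!$ (written $a!!$ if $k=1$) and a receiving action $a??$. All local transitions based on $a$ have the same guard $G_a$. Sends are unique: for each $a_i!!$ there is exactly one transition $s_i\xrightarrow{a_i!!,G_a}s_i'$. Receives are deterministic: for each $s\in S$ there is exactly one state, denoted $M_a(s)$, with $s\xrightarrow{a??,G_a}M_a(s)$. Also write $M_a$ for the linear map $(M_a\cdot\mathbf{x})(t)=\sum_{s:M_a(s)=t}\mathbf{x}(s)$. Put $\mathbf{v}_a(t)=|\{i:s_i=t\}|$, $\mathbf{v}'_a(t)=|\{i:s'_i=t\}|$, $\hat s'=\{s'_1,\dots,s'_k\}$. $\mathcal{G}$ is the set of all guards occurring on transitions of $P$. A *broadcast*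 is a $1$-sender action. An *internal* action is a $1$-sender action with $M_a(s)=s$ for all $s$; its sending transition is an internal transition. A *negotiation* is a synchronous transition of all processes with no distinguished sender, modelled as a set of $1$-sender actions, with common receiving transitions and a common guard, in which every local receiving transition $s\xrightarrow{a??}s'$ is paired with a sending transition $s\xrightarrow{a!!}s'$. A transition is unguarded if its guard is $S$. **Free paths.** A transition of $P$ is *free* if it is (i) an internal transition, (ii) a sending transition of either a broadcast or a $k$-maximal action, or (iii) a receiving transition $r\xrightarrow{a??,G}r'$ of a broadcast with matching sending transition $r\xrightarrow{a!!,G}r'$; case (iii) includes negotiation transitions. A path from one state to another is free if all transitions on the path are free. **Systems.** Global states are $\mathbf{q}\in\mathbb{N}^S$; $\mathrm{supp}(\mathbf{q})=\{s:\mathbf{q}(s)>0\}$. Action $a$ is enabled in $\mathbf{q}$ only if $\mathrm{supp}(\mathbf{q})\subseteq G_a$. Under this condition: if $a$ is $k$-sender, it fires iff $\mathbf{q}(t)\ge\mathbf{v}_a(t)$ for all $t$, and then $\mathbf{q}\xrightarrow{a}M_a\cdot(\mathbf{q}-\mathbf{v}_a)+\mathbf{v}'_a$; if $a$ is $k$-maximal, $\mathbf{q}\xrightarrow{a}\mathbf{q}'$ iff there is a non-empty $I\subseteq\{1,\dots,k\}$ such that, with $\mathbf{u}(t)=|\{i\in I:s_i=t\}|$ and $\mathbf{u}'(t)=|\{i\in I:s'_i=t\}|$, $\mathbf{u}(t)=\min(\mathbf{q}(t),\mathbf{v}_a(t))$ for all $t$ and $\mathbf{q}'=M_a\cdot(\mathbf{q}-\mathbf{u})+\mathbf{u}'$.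 $\mathcal{M}(n)$ is the system whose initial global state has $n$ processes in $s_0$ and none elsewhere. $\mathcal{M}(n)\models\phi_m(s)$ means some global state $\mathbf{q}$ with $\mathbf{q}(s)\ge m$ is reachable in $\mathcal{M}(n)$. **Well-behavedness.** For $t,s\in S$, $H\subseteq S$: $t\triangleleft s$ means $\forall G\in\mathcal{G}\,(s\in G\Rightarrow t\in G)$; $t\triangleleft H$ means $\forall G\in\mathcal{G}\,(H\subseteq G\Rightarrow t\in G)$. $s\rightsquigarrow s'$ means there is a path of unguarded internal transitions from $s$ to $s'$; for $G\subseteq S$, $s\rightsquigarrow_G s'$ means there is a path of internal transitions from $s$ to $s'$ such that each transition is guarded by some $G'\supseteq G$. Action $a$ with guard $G$ is (weakly) guard-compatible if: - ($a$ a $k$-sender action) for all $G'\in\mathcal{G}$: $\hat s'\subseteq G'\Rightarrow\forall s\in G:\bigl(M_a(s)\in G'\vee\exists r\in S:(r\triangleleft\hat s'\wedge M_a(s)\rightsquigarrow r)\bigr)$; - ($a$ a $k$-maximal action) for all $G'\in\mathcal{G}$: $\hat s'\cap G'\ne\varnothing\Rightarrow\bigl(\hat s'\subseteq G'\wedge\forall s\in G:\bigl(M_a(s)\in G'\vee\exists r\in S:((\forall i:\ r\triangleleft s'_i)\wedge M_a(s)\rightsquigarrow r)\bigr)\bigr)$; - ($a$ an internal action with sending transition $s\to s'$) it suffices, instead of the first condition, that for all $G'\in\mathcal{G}$ and all $t\in G$: $(s\notin G'\wedge s'\in G')\Rightarrow\exists t'\in S:(t'\triangleleft s'\wedge t\rightsquigarrow_{G''}t')$,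 where $G''=G\cup\{r\in S:r\triangleleft s'\}$. $P$ is well-behaved if every action is (weakly) guard-compatible. *)

theory Defs
  imports Main
begin

section \<open>Guarded GSP processes\<close>

datatype 'a local_action = Send 'a nat | Recv 'a

fun base :: "'a local_action \<Rightarrow> 'a" where
  "base (Send a i) = a"
| "base (Recv a) = a"

datatype action_kind = KSender | KMaximal

type_synonym ('s, 'a) local_trans = "'s \<times> 'a local_action \<times> 's set \<times> 's"

record ('s, 'a) gsp =
  global_actions :: "'a set"
  arity :: "'a \<Rightarrow> nat"
  kind :: "'a \<Rightarrow> action_kind"
  states :: "'s set"
  init :: "'s"
  trans_rel :: "('s, 'a) local_trans set"

definition local_actions :: "('s, 'a) gsp \<Rightarrow> 'a local_action set" where
  "local_actions P =
     {Send a i | a i. a \<in> global_actions P \<and> 1 \<le> i \<and> i \<le> arity P a} \<union>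
     {Recv a | a. a \<in> global_actions P}"

definition all_guards :: "('s, 'a) gsp \<Rightarrow> 's set set" where
  "all_guards P = {G. \<exists>r l r'. (r, l, G, r') \<in> trans_rel P}"

text \<open>The descriptions in the next four definitions are proper for processes satisfying
  \<open>gsp_process\<close> below; sending actions are indexed from 1.\<close>

definition guard :: "('s, 'a) gsp \<Rightarrow> 'a \<Rightarrow> 's set" where
  "guard P a = (THE G. \<exists>r l r'. base l = a \<and> (r, l, G, r') \<in> trans_rel P)"

definition src :: "('s, 'a) gsp \<Rightarrow> 'a \<Rightarrow> nat \<Rightarrow> 's" where
  "src P a i = (THE r. \<exists>G r'. (r, Send a i, G, r') \<in> trans_rel P)"

definition dst :: "('s, 'a) gsp \<Rightarrow> 'a \<Rightarrow> nat \<Rightarrow> 's" where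
  "dst P a i = (THE r'. \<exists>G r. (r, Send a i, G, r') \<in> trans_rel P)"

definition recv :: "('s, 'a) gsp \<Rightarrow> 'a \<Rightarrow> 's \<Rightarrow> 's" where
  "recv P a r = (THE r'. \<exists>G. (r, Recv a, G, r') \<in> trans_rel P)"

definition gsp_process :: "('s, 'a) gsp \<Rightarrow> bool" where
  "gsp_process P \<longleftrightarrow>
     finite (global_actions P) \<and>
     (\<forall>a\<in>global_actions P. 1 \<le> arity P a) \<and>
     finite (states P) \<and>
     init P \<in> states P \<and>
     trans_rel P \<subseteq> states P \<times> local_actions P \<times> Pow (states P) \<times> states P \<and>
     (\<forall>a\<in>global_actions P. \<exists>G. \<forall>(r, l, G', r')\<in>trans_rel P. base l = a \<longrightarrow> G' = G) \<and>
     (\<forall>a\<in>global_actions P. \<forall>i\<in>{1..arity P a}.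
        \<exists>!(r, G, r'). (r, Send a i, G, r') \<in> trans_rel P) \<and>
     (\<forall>a\<in>global_actions P. \<forall>r\<in>states P.
        \<exists>!(G, r'). (r, Recv a, G, r') \<in> trans_rel P)"

definition dst_set :: "('s, 'a) gsp \<Rightarrow> 'a \<Rightarrow> 's set" where
  "dst_set P a = dst P a ` {1..arity P a}"

definition broadcast :: "('s, 'a) gsp \<Rightarrow> 'a \<Rightarrow> bool" where
  "broadcast P a \<longleftrightarrow> a \<in> global_actions P \<and> kind P a = KSender \<and> arity P a = 1"

definition internal_action :: "('s, 'a) gsp \<Rightarrow> 'a \<Rightarrow> bool" where
  "internal_action P a \<longleftrightarrow> broadcast P a \<and> (\<forall>r\<in>states P. recv P a r = r)"

definition internal_trans :: "('s, 'a) gsp \<Rightarrow> ('s, 'a) local_trans \<Rightarrow> bool" where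
  "internal_trans P \<tau> \<longleftrightarrow> \<tau> \<in> trans_rel P \<and>
     (\<exists>a r G r'. internal_action P a \<and> \<tau> = (r, Send a 1, G, r'))"

text \<open>The last conjunct expresses that a negotiation has no distinguished sender:
  the sending process moves as it would have moved by receiving.\<close>

definition negotiation :: "('s, 'a) gsp \<Rightarrow> 'a set \<Rightarrow> bool" where
  "negotiation P N \<longleftrightarrow>
     (\<forall>a\<in>N. broadcast P a) \<and>
     (\<forall>a\<in>N. \<forall>b\<in>N. guard P a = guard P b) \<and>
     (\<forall>a\<in>N. \<forall>b\<in>N. \<forall>r\<in>states P. recv P a r = recv P b r) \<and>
     (\<forall>a\<in>N. \<forall>r\<in>states P. \<exists>b\<in>N. src P b 1 = r \<and> dst P b 1 = recv P a r) \<and>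
     (\<forall>a\<in>N. dst P a 1 = recv P a (src P a 1))"


section \<open>Free paths\<close>

text \<open>Each action of a negotiation has its own unique sending transition, so the send matching
  a receive of a negotiation action \<open>a\<close> may belong to another action \<open>b\<close> of the same negotiation.\<close>

definition free_trans :: "('s, 'a) gsp \<Rightarrow> ('s, 'a) local_trans \<Rightarrow> bool" where
  "free_trans P \<tau> \<longleftrightarrow> \<tau> \<in> trans_rel P \<and>
     (internal_trans P \<tau> \<or>
      (\<exists>a i r G r'. \<tau> = (r, Send a i, G, r') \<and> (broadcast P a \<or> kind P a = KMaximal)) \<or>
      (\<exists>a b r G r'. \<tau> = (r, Recv a, G, r') \<and> broadcast P a \<and>
         (b = a \<or> (\<exists>N. negotiation P N \<and> a \<in> N \<and> b \<in> N)) \<and>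
         (r, Send b 1, G, r') \<in> trans_rel P))"

text \<open>Paths range over all of \<open>trans_rel\<close>; in particular receiving self-loops count as steps.\<close>

fun is_path :: "('s, 'a) gsp \<Rightarrow> 's \<Rightarrow> ('s, 'a) local_trans list \<Rightarrow> 's \<Rightarrow> bool" where
  "is_path P r [] t \<longleftrightarrow> r = t"
| "is_path P r ((p, l, G, p') # \<tau>s) t \<longleftrightarrow>
     (p, l, G, p') \<in> trans_rel P \<and> p = r \<and> is_path P p' \<tau>s t"

definition free_path :: "('s, 'a) gsp \<Rightarrow> ('s, 'a) local_trans list \<Rightarrow> bool" where
  "free_path P \<tau>s \<longleftrightarrow> (\<forall>\<tau>\<in>set \<tau>s. free_trans P \<tau>)"


section \<open>Global semantics\<close>

text \<open>Global states are functions of type \<open>'s \<Rightarrow> nat\<close>; every reachable one vanishes outside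
  \<open>states P\<close>. The pointwise natural-number subtractions in \<open>fires\<close> never truncate.\<close>

definition supp :: "('s \<Rightarrow> nat) \<Rightarrow> 's set" where
  "supp q = {t. q t > 0}"

definition recv_map :: "('s, 'a) gsp \<Rightarrow> 'a \<Rightarrow> ('s \<Rightarrow> nat) \<Rightarrow> 's \<Rightarrow> nat" where
  "recv_map P a x t = (\<Sum>r | r \<in> states P \<and> recv P a r = t. x r)"

definition src_count :: "('s, 'a) gsp \<Rightarrow> 'a \<Rightarrow> nat set \<Rightarrow> 's \<Rightarrow> nat" where
  "src_count P a I t = card {i \<in> I. src P a i = t}"

definition dst_count :: "('s, 'a) gsp \<Rightarrow> 'a \<Rightarrow> nat set \<Rightarrow> 's \<Rightarrow> nat" where
  "dst_count P a I t = card {i \<in> I. dst P a i = t}"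

definition fires :: "('s, 'a) gsp \<Rightarrow> 'a \<Rightarrow> ('s \<Rightarrow> nat) \<Rightarrow> ('s \<Rightarrow> nat) \<Rightarrow> bool" where
  "fires P a q q' \<longleftrightarrow> supp q \<subseteq> guard P a \<and>
     (case kind P a of
        KSender \<Rightarrow>
          (\<forall>t. src_count P a {1..arity P a} t \<le> q t) \<and>
          q' = (\<lambda>t. recv_map P a (\<lambda>r. q r - src_count P a {1..arity P a} r) t
                     + dst_count P a {1..arity P a} t)
      | KMaximal \<Rightarrow>
          (\<exists>I. I \<noteq> {} \<and> I \<subseteq> {1..arity P a} \<and>
             (\<forall>t. src_count P a I t = min (q t) (src_count P a {1..arity P a} t)) \<and>
             q' = (\<lambda>t. recv_map P a (\<lambda>r. q r - src_count P a I r) t + dst_count P a I t)))"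

definition global_step :: "('s, 'a) gsp \<Rightarrow> ('s \<Rightarrow> nat) \<Rightarrow> ('s \<Rightarrow> nat) \<Rightarrow> bool" where
  "global_step P q q' \<longleftrightarrow> (\<exists>a\<in>global_actions P. fires P a q q')"

definition init_global :: "('s, 'a) gsp \<Rightarrow> nat \<Rightarrow> 's \<Rightarrow> nat" where
  "init_global P n = (\<lambda>t. if t = init P then n else 0)"

text \<open>\<open>sat_phi P n m s\<close>: the system with \<open>n\<close> processes can reach a global state with at least
  \<open>m\<close> processes in \<open>s\<close>.\<close>

definition sat_phi :: "('s, 'a) gsp \<Rightarrow> nat \<Rightarrow> nat \<Rightarrow> 's \<Rightarrow> bool" where
  "sat_phi P n m s \<longleftrightarrow> (\<exists>q. (global_step P)\<^sup>*\<^sup>* (init_global P n) q \<and> m \<le> q s)"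

definition is_cutoff :: "('s, 'a) gsp \<Rightarrow> nat \<Rightarrow> nat \<Rightarrow> 's \<Rightarrow> bool" where
  "is_cutoff P c m s \<longleftrightarrow> ((\<exists>n. sat_phi P n m s) \<longleftrightarrow> sat_phi P c m s)"

definition synchronization_independent :: "('s, 'a) gsp \<Rightarrow> 's \<Rightarrow> bool" where
  "synchronization_independent P s \<longleftrightarrow> (\<forall>m. is_cutoff P m m s)"


section \<open>Well-behavedness\<close>

definition dominated :: "('s, 'a) gsp \<Rightarrow> 's \<Rightarrow> 's \<Rightarrow> bool" where
  "dominated P t s \<longleftrightarrow> (\<forall>G\<in>all_guards P. s \<in> G \<longrightarrow> t \<in> G)"

definition dominated_set :: "('s, 'a) gsp \<Rightarrow> 's \<Rightarrow> 's set \<Rightarrow> bool" where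
  "dominated_set P t H \<longleftrightarrow> (\<forall>G\<in>all_guards P. H \<subseteq> G \<longrightarrow> t \<in> G)"

text \<open>Paths of internal transitions may be empty.\<close>

definition unguarded_internal_path :: "('s, 'a) gsp \<Rightarrow> 's \<Rightarrow> 's \<Rightarrow> bool" where
  "unguarded_internal_path P =
     (\<lambda>r r'. \<exists>l. internal_trans P (r, l, states P, r'))\<^sup>*\<^sup>*"

definition guarded_internal_path :: "('s, 'a) gsp \<Rightarrow> 's set \<Rightarrow> 's \<Rightarrow> 's \<Rightarrow> bool" where
  "guarded_internal_path P G =
     (\<lambda>r r'. \<exists>l G'. G \<subseteq> G' \<and> internal_trans P (r, l, G', r'))\<^sup>*\<^sup>*"

definition guard_compatible_sender :: "('s, 'a) gsp \<Rightarrow> 'a \<Rightarrow> bool" where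
  "guard_compatible_sender P a \<longleftrightarrow>
     (\<forall>G'\<in>all_guards P. dst_set P a \<subseteq> G' \<longrightarrow>
        (\<forall>t\<in>guard P a. recv P a t \<in> G' \<or>
           (\<exists>r\<in>states P. dominated_set P r (dst_set P a) \<and>
              unguarded_internal_path P (recv P a t) r)))"

definition guard_compatible_maximal :: "('s, 'a) gsp \<Rightarrow> 'a \<Rightarrow> bool" where
  "guard_compatible_maximal P a \<longleftrightarrow>
     (\<forall>G'\<in>all_guards P. dst_set P a \<inter> G' \<noteq> {} \<longrightarrow>
        dst_set P a \<subseteq> G' \<and>
        (\<forall>t\<in>guard P a. recv P a t \<in> G' \<or>
           (\<exists>r\<in>states P. (\<forall>i\<in>{1..arity P a}. dominated P r (dst P a i)) \<and>
              unguarded_internal_path P (recv P a t) r)))"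

definition guard_compatible_internal :: "('s, 'a) gsp \<Rightarrow> 'a \<Rightarrow> bool" where
  "guard_compatible_internal P a \<longleftrightarrow>
     (\<forall>G'\<in>all_guards P. \<forall>t\<in>guard P a.
        src P a 1 \<notin> G' \<and> dst P a 1 \<in> G' \<longrightarrow>
        (\<exists>t'\<in>states P. dominated P t' (dst P a 1) \<and>
           guarded_internal_path P
             (guard P a \<union> {r \<in> states P. dominated P r (dst P a 1)}) t t'))"

definition weakly_guard_compatible :: "('s, 'a) gsp \<Rightarrow> 'a \<Rightarrow> bool" where
  "weakly_guard_compatible P a \<longleftrightarrow>
     (case kind P a of
        KSender \<Rightarrow> guard_compatible_sender P a \<or>
                   (internal_action P a \<and> guard_compatible_internal P a)
      | KMaximal \<Rightarrow> guard_compatible_maximal P a)"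

definition well_behaved :: "('s, 'a) gsp \<Rightarrow> bool" where
  "well_behaved P \<longleftrightarrow> (\<forall>a\<in>global_actions P. weakly_guard_compatible P a)"

end

theory Submission
  imports Defs
begin

text \<open>Guards are closed under passing to smaller supports, so it suffices to follow an arbitrary
  sub-configuration of \<open>m\<close> processes backwards from \<open>s\<close> to \<open>init P\<close>. Every local transition of such
  a process lies on a path from \<open>init P\<close> to \<open>s\<close>, hence is free. Therefore a maximal action has
  all followed processes as senders, and every sender action is a broadcast. If the sender of the
  broadcast is not followed, any followed process can send in its place, by the matching send.\<close>

section \<open>Sums of natural numbers and cardinalities of fibres\<close>

lemma sum_nat_posD:
  fixes f :: "'b \<Rightarrow> nat"
  shows "0 < sum f A \<Longrightarrow> \<exists>x\<in>A. 0 < f x"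
  by (rule ccontr) simp

lemma sum_nat_split_below:
  fixes f :: "'b \<Rightarrow> nat"
  assumes "finite A" "k \<le> sum f A"
  shows "\<exists>g. (\<forall>x. g x \<le> f x) \<and> sum g A = k"
  using assms
proof (induction A arbitrary: k rule: finite_induct)
  case empty
  then show ?case by auto
next
  case (insert a A)
  \<comment> \<open>Greedy choice: the new element takes as much of \<open>k\<close> as
    \<open>f a\<close> allows, so the remainder fits below the sum over \<open>A\<close>.\<close>
  have "k - min k (f a) \<le> sum f A" using insert by auto
  then obtain g where g: "\<forall>x. g x \<le> f x" "sum g A = k - min k (f a)"
    using insert.IH by blast
  have "sum (g(a := min k (f a))) A = sum g A"
    using insert.hyps by (intro sum.cong) auto
  then have "sum (g(a := min k (f a))) (insert a A) = k"
    using insert.hyps g(2) by simp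
  then show ?case using g(1) by (intro exI[of _ "g(a := min k (f a))"]) auto
qed

lemma sum_card_fibres:
  assumes "finite S" "finite I" "f ` I \<subseteq> S"
  shows "(\<Sum>t\<in>S. card {i \<in> I. f i = t}) = card I"
  using sum.group[OF assms(2,1,3), of "\<lambda>_. 1::nat"] by simp

lemma card_fibre_posD: "0 < card {i \<in> I. f i = t} \<Longrightarrow> \<exists>i\<in>I. f i = t"
  by (auto simp: card_gt_0_iff)

lemma card_fibre_singleton: "card {i \<in> {k}. f i = t} = (if f k = t then 1 else 0)"
proof -
  have "{i \<in> {k}. f i = t} = (if f k = t then {k} else {})" by auto
  then show ?thesis by simp
qed

text \<open>Fibres over different points are disjoint, so a subset of the right size can be chosen
  in each one independently. It serves to pick, among the senders of a step, those that account for
  prescribed numbers of processes in the destinations.\<close>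

lemma subset_with_fibre_cards:
  assumes "finite I" "\<And>t. c t \<le> card {i \<in> I. f i = t}"
  shows "\<exists>J\<subseteq>I. \<forall>t. card {i \<in> J. f i = t} = c t"
proof -
  have "\<exists>K. K \<subseteq> {i \<in> I. f i = t} \<and> card K = c t" for t
    using assms(2)[of t] by (meson obtain_subset_with_card_n)
  then obtain K where K: "\<And>t. K t \<subseteq> {i \<in> I. f i = t}" "\<And>t. card (K t) = c t"
    by metis
  have "{i \<in> (\<Union>t. K t). f i = t} = K t" for t using K(1) by blast
  moreover have "(\<Union>t. K t) \<subseteq> I" using K(1) by blast
  ultimately show ?thesis using K(2) by metis
qed

section \<open>Paths in the local transition graph\<close>

lemma is_path_append:
  "is_path P r xs u \<Longrightarrow> is_path P u ys t \<Longrightarrow> is_path P r (xs @ ys) t"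
  by (induction P r xs u rule: is_path.induct) auto

text \<open>Guards do not restrict these paths: the freeness hypothesis concerns all local paths, so
  reachability in the bare transition graph is the matching notion.\<close>

definition connected_to :: "('s, 'a) gsp \<Rightarrow> 's \<Rightarrow> 's \<Rightarrow> bool" where
  "connected_to P r t \<longleftrightarrow> (\<exists>\<tau>s. is_path P r \<tau>s t)"

lemma connected_to_refl: "connected_to P r r"
  unfolding connected_to_def by (intro exI[of _ "[]"]) simp

lemma connected_to_trans:
  "connected_to P r u \<Longrightarrow> connected_to P u t \<Longrightarrow> connected_to P r t"
  unfolding connected_to_def using is_path_append by metis

lemma connected_to_step: "(r, l, G, t) \<in> trans_rel P \<Longrightarrow> connected_to P r t"
  unfolding connected_to_def by (intro exI[of _ "[(r, l, G, t)]"]) simp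

text \<open>The transition sits in the middle of a path from \<open>r\<close> to \<open>t\<close>.
  This turns the hypothesis on whole paths into freeness of single transitions.\<close>

lemma trans_on_free_path:
  assumes "\<And>\<tau>s. is_path P r \<tau>s t \<Longrightarrow> free_path P \<tau>s"
    and "connected_to P r u" "(u, l, G, u') \<in> trans_rel P" "connected_to P u' t"
  shows "free_trans P (u, l, G, u')"
proof -
  obtain xs ys where xs: "is_path P r xs u" and ys: "is_path P u' ys t"
    using assms(2,4) unfolding connected_to_def by blast
  have "is_path P r (xs @ (u, l, G, u') # ys) t"
    by (rule is_path_append[OF xs]) (use assms(3) ys in simp)
  from assms(1)[OF this] show ?thesis unfolding free_path_def by simp
qed

section \<open>Guards, sends and receives as determined by the transition relation\<close>

context
  fixes P :: "('s, 'a) gsp"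
  assumes process: "gsp_process P"
begin

lemma finite_states: "finite (states P)"
  using process unfolding gsp_process_def by blast

lemma trans_states:
  assumes "(r, l, G, r') \<in> trans_rel P"
  shows "r \<in> states P" "l \<in> local_actions P" "r' \<in> states P"
proof -
  have "trans_rel P \<subseteq> states P \<times> local_actions P \<times> Pow (states P) \<times> states P"
    using process unfolding gsp_process_def by blast
  with assms show "r \<in> states P" "l \<in> local_actions P" "r' \<in> states P" by blast+
qed

lemma base_trans_global: "(r, l, G, r') \<in> trans_rel P \<Longrightarrow> base l \<in> global_actions P"
  using trans_states(2) unfolding local_actions_def by fastforce

lemma common_guard:
  assumes "a \<in> global_actions P"
  shows "\<exists>G. \<forall>(r, l, G', r')\<in>trans_rel P. base l = a \<longrightarrow> G' = G"
proof -
  have "\<forall>a\<in>global_actions P. \<exists>G. \<forall>(r, l, G', r')\<in>trans_rel P. base l = a \<longrightarrow> G' = G"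
    using process unfolding gsp_process_def by (elim conjE) assumption
  then show ?thesis using assms by (rule bspec)
qed

lemma guard_eq:
  assumes "(r, l, G, r') \<in> trans_rel P"
  shows "guard P (base l) = G"
proof -
  obtain H where H: "\<forall>(r, l', G', r')\<in>trans_rel P. base l' = base l \<longrightarrow> G' = H"
    using common_guard[OF base_trans_global[OF assms]] by (elim exE)
  have "G' = H" if "base l' = base l" "(u, l', G', u') \<in> trans_rel P" for G' u l' u'
    using bspec[OF H that(2)] that(1) by simp
  with assms have "G' = G" if "base l' = base l" "(u, l', G', u') \<in> trans_rel P" for G' u l' u'
    using that by metis
  then show ?thesis unfolding guard_def using assms by (intro the_equality) blast+
qed

lemma send_unique:
  assumes "a \<in> global_actions P" "i \<in> {1..arity P a}"
  shows "\<exists>!(r, G, r'). (r, Send a i, G, r') \<in> trans_rel P"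
proof -
  have "\<forall>a\<in>global_actions P. \<forall>i\<in>{1..arity P a}. \<exists>!(r, G, r'). (r, Send a i, G, r') \<in> trans_rel P"
    using process unfolding gsp_process_def by (elim conjE) assumption
  from bspec[OF bspec[OF this assms(1)] assms(2)] show ?thesis .
qed

lemma src_dst_eq:
  assumes t: "(r, Send a i, G, r') \<in> trans_rel P"
  shows "src P a i = r" "dst P a i = r'"
proof -
  have ai: "a \<in> global_actions P" "i \<in> {1..arity P a}"
    using trans_states(2)[OF t] unfolding local_actions_def by auto
  have "\<And>u H u'. (u, Send a i, H, u') \<in> trans_rel P \<Longrightarrow> u = r \<and> u' = r'"
    using send_unique[OF ai] t by fast
  then show "src P a i = r" "dst P a i = r'"
    unfolding src_def dst_def using t by (intro the_equality; blast)+
qed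

lemma send_trans:
  assumes "a \<in> global_actions P" "i \<in> {1..arity P a}"
  shows "(src P a i, Send a i, guard P a, dst P a i) \<in> trans_rel P"
proof -
  obtain r G r' where t: "(r, Send a i, G, r') \<in> trans_rel P"
    using send_unique[OF assms] by fast
  then show ?thesis using src_dst_eq[OF t] guard_eq[OF t] by simp
qed

lemma recv_trans:
  assumes "a \<in> global_actions P" "r \<in> states P"
  shows "(r, Recv a, guard P a, recv P a r) \<in> trans_rel P"
proof -
  have "\<forall>a\<in>global_actions P. \<forall>r\<in>states P. \<exists>!(G, r'). (r, Recv a, G, r') \<in> trans_rel P"
    using process unfolding gsp_process_def by (elim conjE) assumption
  with assms have u: "\<exists>!(G, r'). (r, Recv a, G, r') \<in> trans_rel P" by simp
  then obtain G r' where t: "(r, Recv a, G, r') \<in> trans_rel P" by fast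
  have "\<And>H u'. (r, Recv a, H, u') \<in> trans_rel P \<Longrightarrow> u' = r'"
    using u t by (metis (mono_tags, lifting) case_prod_conv prod.inject)
  then have "recv P a r = r'" unfolding recv_def using t by (intro the_equality) blast+
  then show ?thesis using t guard_eq[OF t] by simp
qed

lemmas src_states = trans_states(1)[OF send_trans]
lemmas dst_states = trans_states(3)[OF send_trans]
lemmas recv_states = trans_states(3)[OF recv_trans]

section \<open>The linear map of the receiving transitions\<close>

lemma recv_map_add: "recv_map P a (\<lambda>r. x r + y r) t = recv_map P a x t + recv_map P a y t"
  unfolding recv_map_def by (simp add: sum.distrib)

lemma recv_map_single:
  assumes "r \<in> states P"
  shows "recv_map P a (\<lambda>u. if u = r then 1 else 0) t = (if recv P a r = t then 1 else 0)"
proof -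
  have "recv_map P a (\<lambda>u. if u = r then 1 else 0) t
      = (\<Sum>u | u \<in> states P \<and> recv P a u = t. if r = u then 1 else 0)"
    unfolding recv_map_def by (intro sum.cong) auto
  also have "\<dots> = (if recv P a r = t then 1 else 0)"
    using assms finite_states by (subst sum.delta') auto
  finally show ?thesis .
qed

lemma recv_map_cong:
  "(\<And>r. r \<in> states P \<Longrightarrow> recv P a r = recv P b r) \<Longrightarrow> recv_map P a = recv_map P b"
  unfolding recv_map_def by (intro ext sum.cong) auto

lemma recv_map_ge:
  assumes "r \<in> states P"
  shows "x r \<le> recv_map P a x (recv P a r)"
  unfolding recv_map_def using assms finite_states by (intro member_le_sum) auto

lemma recv_map_pos:
  assumes "recv_map P a x t > 0"
  shows "\<exists>r\<in>states P. recv P a r = t \<and> x r > 0"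
  using sum_nat_posD[OF assms[unfolded recv_map_def]] by blast

text \<open>Every local state has exactly one image, again in \<open>states P\<close>, so the fibres
  partition the sum: receiving preserves the number of processes.\<close>

lemma sum_recv_map:
  assumes "a \<in> global_actions P"
  shows "sum (recv_map P a x) (states P) = sum x (states P)"
  unfolding recv_map_def
  using sum.group[OF finite_states finite_states, of "recv P a" x] recv_states[OF assms] by auto

text \<open>If only some of the processes are followed after a receive, this selects where they were
  before it: the fibres of \<open>recv P a\<close> are disjoint, so the selection is made separately
  above each target state.\<close>

lemma recv_map_lift:
  assumes "\<And>t. y t \<le> recv_map P a x t"
  shows "\<exists>z. (\<forall>r. z r \<le> x r) \<and> (\<forall>r. r \<notin> states P \<longrightarrow> z r = 0) \<and> recv_map P a z = y"
proof -
  have "\<exists>g. (\<forall>r. g r \<le> x r) \<and> (\<Sum>r | r \<in> states P \<and> recv P a r = t. g r) = y t" for t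
    using assms[of t] finite_states unfolding recv_map_def by (intro sum_nat_split_below) auto
  then obtain g where g: "\<And>t r. g t r \<le> x r"
    "\<And>t. (\<Sum>r | r \<in> states P \<and> recv P a r = t. g t r) = y t" by metis
  \<comment> \<open>Each state lies in just one fibre and takes its value from the selection made
    for that fibre.\<close>
  define z where "z r = (if r \<in> states P then g (recv P a r) r else 0)" for r
  have "recv_map P a z t = y t" for t
    unfolding recv_map_def g(2)[of t, symmetric] by (intro sum.cong) (auto simp: z_def)
  then show ?thesis using g(1) by (intro exI[of _ z]) (auto simp: z_def)
qed

section \<open>Global steps: following sub-configurations backwards and replaying them\<close>

lemma fires_decompose:
  assumes "fires P a q q'"
  shows "supp q \<subseteq> guard P a \<and> (\<exists>I\<subseteq>{1..arity P a}.
    (\<forall>t. src_count P a I t \<le> q t) \<and>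
    q' = (\<lambda>t. recv_map P a (\<lambda>r. q r - src_count P a I r) t + dst_count P a I t))"
\<comment> \<open>Both kinds of action are brought to one shape, a set \<open>I\<close> of actual
  senders: all indices for a sender action, the chosen ones for a maximal action.\<close>
proof (cases "kind P a")
  case KSender
  show ?thesis
    using assms unfolding fires_def KSender action_kind.case
    by (elim conjE, intro conjI exI[of _ "{1..arity P a}"]) (assumption | rule order_refl)+
next
  case KMaximal
  obtain I where "supp q \<subseteq> guard P a" "I \<subseteq> {1..arity P a}"
    "\<forall>t. src_count P a I t = min (q t) (src_count P a {1..arity P a} t)"
    "q' = (\<lambda>t. recv_map P a (\<lambda>r. q r - src_count P a I r) t + dst_count P a I t)"
    using assms unfolding fires_def KMaximal action_kind.case by blast
  then show ?thesis by (metis min.cobounded1)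
qed

text \<open>A process that ends up in \<open>t\<close> arrived by a single local transition, a
  receive or a send, from a state occupied before the step. Its history is therefore a local
  path.\<close>

lemma supp_reachable:
  assumes "(global_step P)\<^sup>*\<^sup>* (init_global P n) q" "q t > 0"
  shows "t \<in> states P \<and> connected_to P (init P) t"
  using assms
proof (induction arbitrary: t rule: rtranclp_induct)
  case base
  then have "t = init P" unfolding init_global_def by (simp split: if_splits)
  then show ?case using connected_to_refl process unfolding gsp_process_def by auto
next
  case (step q q')
  obtain a where a: "a \<in> global_actions P" and f: "fires P a q q'"
    using step.hyps(2) unfolding global_step_def by blast
  obtain I where I: "I \<subseteq> {1..arity P a}" "\<And>t. src_count P a I t \<le> q t"
    "q' t = recv_map P a (\<lambda>r. q r - src_count P a I r) t + dst_count P a I t"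
    using fires_decompose[OF f] by blast
  consider "recv_map P a (\<lambda>r. q r - src_count P a I r) t > 0" | "dst_count P a I t > 0"
    using step.prems I(3) by linarith
  then obtain r l G where "q r > 0" "(r, l, G, t) \<in> trans_rel P"
  proof cases
    case 1
    then obtain r where "r \<in> states P" "recv P a r = t" "q r > 0"
      using recv_map_pos[OF 1] by (metis diff_le_self gr_zeroI leD)
    then show ?thesis using that recv_trans[OF a] by blast
  next
    case 2
    obtain i where i: "i \<in> I" "dst P a i = t"
      using card_fibre_posD[OF 2[unfolded dst_count_def]] by blast
    have "finite I" using I(1) finite_subset by blast
    then have "src_count P a I (src P a i) > 0"
      unfolding src_count_def using i by (auto simp: card_gt_0_iff)
    then have "q (src P a i) > 0" using I(2)[of "src P a i"] by linarith
    then show ?thesis using that send_trans[OF a, of i] i I(1) by blast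
  qed
  then show ?case
    using step.IH connected_to_trans connected_to_step trans_states(3) by metis
qed

text \<open>Going one step back, the followed processes \<open>x'\<close> split into receivers,
  located by \<open>y\<close>, and senders, indexed by \<open>J\<close>. Together they form a
  sub-configuration of \<open>q\<close>.\<close>

lemma sub_configuration_predecessor:
  assumes a: "a \<in> global_actions P" and f: "fires P a q q'" and x': "\<And>t. x' t \<le> q' t"
  shows "\<exists>y J. J \<subseteq> {1..arity P a} \<and> (\<forall>r. y r + src_count P a J r \<le> q r) \<and>
    (\<forall>r. r \<notin> states P \<longrightarrow> y r = 0) \<and>
    (\<forall>t. x' t = recv_map P a y t + dst_count P a J t)"
proof -
  obtain I where I: "I \<subseteq> {1..arity P a}" "\<And>t. src_count P a I t \<le> q t"
    "\<And>t. q' t = recv_map P a (\<lambda>r. q r - src_count P a I r) t + dst_count P a I t"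
    using fires_decompose[OF f] by metis
  have fI: "finite I" using I(1) finite_subset by blast
  \<comment> \<open>As many followed processes as possible are attributed to senders. What is left
    over in \<open>t\<close> is either zero or bounded by the receivers arriving there.\<close>
  define w where "w t = min (x' t) (dst_count P a I t)" for t
  obtain J where J: "J \<subseteq> I" "\<And>t. dst_count P a J t = w t"
    using subset_with_fibre_cards[OF fI, of w "dst P a"]
    unfolding w_def dst_count_def by force
  have le: "x' t - w t \<le> recv_map P a (\<lambda>r. q r - src_count P a I r) t" for t
    using x'[of t] I(3)[of t] unfolding w_def by auto
  obtain y where y: "\<And>r. y r \<le> q r - src_count P a I r"
    "\<forall>r. r \<notin> states P \<longrightarrow> y r = 0" "recv_map P a y = (\<lambda>t. x' t - w t)"
    using recv_map_lift[OF le] by blast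
  \<comment> \<open>Since \<open>y\<close> avoids all senders in \<open>I\<close>, it leaves room
    for those in \<open>J\<close>.\<close>
  have mono: "src_count P a J r \<le> src_count P a I r" for r
    unfolding src_count_def using fI J(1) by (intro card_mono) auto
  have "y r + src_count P a J r \<le> q r" for r
    using y(1)[of r] I(2)[of r] mono[of r] by linarith
  moreover have "x' t = recv_map P a y t + dst_count P a J t" for t
    using y(3) J(2)[of t] unfolding w_def by auto
  ultimately show ?thesis using y(2) subset_trans[OF J(1) I(1)]
    by (intro exI[of _ y] exI[of _ J]) simp
qed

text \<open>The followed processes, \<open>y\<close> receiving and \<open>J\<close> sending, can
  make the same move with all other processes absent. The action may have to be replaced by another
  one of the same negotiation when the original sender is not followed.\<close>

lemma free_sub_configuration_steps:
  assumes a: "a \<in> global_actions P" and J: "J \<subseteq> {1..arity P a}"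
    and y: "\<And>r. r \<notin> states P \<Longrightarrow> y r = 0"
    and x: "x = (\<lambda>r. y r + src_count P a J r)"
    and x': "x' = (\<lambda>t. recv_map P a y t + dst_count P a J t)"
    and guard: "supp x \<subseteq> guard P a"
    and nonempty: "sum x (states P) > 0"
    and recv_free: "\<And>r. y r > 0 \<Longrightarrow> free_trans P (r, Recv a, guard P a, recv P a r)"
    and send_free: "\<And>i. i \<in> J \<Longrightarrow> free_trans P (src P a i, Send a i, guard P a, dst P a i)"
  shows "global_step P x x'"
proof (cases "kind P a")
  case KMaximal
  \<comment> \<open>A receive is free only for a broadcast, so no receiver of a maximal action is
    followed.\<close>
  have y0: "y = (\<lambda>_. 0)"
  proof (rule ext, rule ccontr)
    fix r assume "y r \<noteq> 0"
    with recv_free[of r] KMaximal show False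
      unfolding free_trans_def internal_trans_def broadcast_def by auto
  qed
  have fJ: "finite J" using J finite_subset by blast
  \<comment> \<open>Now \<open>x\<close> consists of the senders in \<open>J\<close> alone, so the
    minimum in the maximal clause equals \<open>src_count P a J\<close> and \<open>J\<close> itself
    is the witness.\<close>
  have "src_count P a J t \<le> src_count P a {1..arity P a} t" for t
    unfolding src_count_def using J by (intro card_mono) auto
  moreover have "J \<noteq> {}" using nonempty unfolding x y0 src_count_def by auto
  ultimately have "fires P a x x'"
    unfolding fires_def KMaximal using guard J
    by (auto simp: x x' y0 intro!: exI[of _ J])
  then show ?thesis using a unfolding global_step_def by blast
next
  case KSender
  show ?thesis
  proof (cases "J = {}")
    case False
    then obtain i where "i \<in> J" by blast
    \<comment> \<open>A free send of a sender action belongs to a broadcast, also when it is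
      internal. The arity is then 1, and the non-empty \<open>J\<close> contains the only
      sender.\<close>
    then have "broadcast P a"
      using send_free[of i] KSender unfolding free_trans_def internal_trans_def internal_action_def
      by auto
    then have "J = {1..arity P a}" using J False unfolding broadcast_def by auto
    then have "fires P a x x'"
      unfolding fires_def KSender using guard by (simp add: x x')
    then show ?thesis using a unfolding global_step_def by blast
  next
    case True
    have xy: "x = y" unfolding x True src_count_def by simp
    \<comment> \<open>The actual sender is not followed. Any followed process, here one in
      \<open>r\<close>, can replace it, because its free receive has a matching send.\<close>
    obtain r where r: "r \<in> states P" "y r > 0"
      using sum_nat_posD[OF nonempty[unfolded xy]] by blast
    have "free_trans P (r, Recv a, guard P a, recv P a r)" using recv_free r by blast
    then obtain b where ba: "broadcast P a"
      and b: "b = a \<or> (\<exists>N. negotiation P N \<and> a \<in> N \<and> b \<in> N)"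
      and t: "(r, Send b 1, guard P a, recv P a r) \<in> trans_rel P"
      unfolding free_trans_def internal_trans_def by auto
    \<comment> \<open>For \<open>b\<close> different from \<open>a\<close>, the negotiation supplies
      equal receives; the equal guards can be read off the matching send.\<close>
    have bb: "broadcast P b" and ab: "recv_map P b = recv_map P a"
      using b ba recv_map_cong unfolding negotiation_def by metis+
    have gb: "guard P b = guard P a" using guard_eq[OF t] by simp
    have arity: "{1..arity P b} = {1}" and kind: "kind P b = KSender"
      using bb unfolding broadcast_def by auto
    \<comment> \<open>\<open>e\<close> is the one process promoted to sender and \<open>d\<close>
      are the remaining receivers.\<close>
    define e where "e = (\<lambda>u. if u = r then 1 else 0 :: nat)"
    define d where "d = (\<lambda>u. x u - e u)"
    have src: "src_count P b {1..arity P b} = e"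
      unfolding src_count_def arity card_fibre_singleton src_dst_eq(1)[OF t] e_def by auto
    have dst: "dst_count P b {1..arity P b} = (\<lambda>u. if recv P a r = u then 1 else 0)"
      unfolding dst_count_def arity card_fibre_singleton src_dst_eq(2)[OF t] by simp
    have le: "e u \<le> x u" for u using r(2) unfolding e_def xy by auto
    then have xd: "x = (\<lambda>u. d u + e u)" unfolding d_def by auto
    \<comment> \<open>By linearity the promoted process can be split off; its send leads to
      \<open>recv P a r\<close>, exactly where its receive would have led, so the result is
      unchanged.\<close>
    have "x' = recv_map P a x" unfolding x' xy True dst_count_def by simp
    also have "\<dots> = (\<lambda>u. recv_map P a d u + (if recv P a r = u then 1 else 0))"
      by (subst xd, rule ext) (simp add: recv_map_add e_def recv_map_single[OF r(1)])
    finally have "fires P b x x'"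
      unfolding fires_def kind action_kind.case src dst gb ab using guard le
      by (simp add: d_def)
    then show ?thesis using bb unfolding global_step_def broadcast_def by blast
  qed
qed

text \<open>The configuration \<open>x\<close> need not be concentrated in \<open>s\<close>, since
  processes that meet in \<open>s\<close> come from different states earlier in the run. The
  induction keeps two invariants: there are \<open>m\<close> of them, and each can still reach
  \<open>s\<close> locally.\<close>

lemma sub_configuration_reachable:
  assumes free: "\<And>\<tau>s. is_path P (init P) \<tau>s s \<Longrightarrow> free_path P \<tau>s"
    and "(global_step P)\<^sup>*\<^sup>* (init_global P n) q"
    and "\<And>t. x t \<le> q t" "sum x (states P) = m" "m > 0"
    and "\<And>t. x t > 0 \<Longrightarrow> connected_to P t s"
  shows "(global_step P)\<^sup>*\<^sup>* (init_global P m) x"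
  using assms(2-)
proof (induction arbitrary: x rule: rtranclp_induct)
  case base
  have z: "x t = 0" if "t \<noteq> init P" for t
    using base(1)[of t] that unfolding init_global_def by simp
  have "init P \<in> states P" using process unfolding gsp_process_def by blast
  then have "sum x (states P) = x (init P)"
    using finite_states z by (subst sum.remove[of _ "init P"]) auto
  \<comment> \<open>The run of \<open>n\<close> processes has been followed back to its start; only
    the \<open>m\<close> followed ones remain, all in the initial state.\<close>
  then have "x = init_global P m" using z base(2) unfolding init_global_def by auto
  then show ?case by simp
next
  case (step q q')
  obtain a where a: "a \<in> global_actions P" and f: "fires P a q q'"
    using step.hyps(2) unfolding global_step_def by blast
  obtain y J where J: "J \<subseteq> {1..arity P a}"
    and le: "\<And>r. y r + src_count P a J r \<le> q r"
    and y: "\<And>r. r \<notin> states P \<Longrightarrow> y r = 0"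
    and x: "\<And>t. x t = recv_map P a y t + dst_count P a J t"
    using sub_configuration_predecessor[OF a f step.prems(1)] by metis
  \<comment> \<open>\<open>z\<close> is the followed sub-configuration before the step.\<close>
  define z where "z = (\<lambda>r. y r + src_count P a J r)"
  have fJ: "finite J" using J finite_subset by blast
  have ystates: "r \<in> states P" if "y r > 0" for r using y that by fastforce
  have recv_to: "connected_to P (recv P a r) s" if "y r > 0" for r
    using step.prems(4)[of "recv P a r"] x[of "recv P a r"]
      recv_map_ge[OF ystates[OF that], of y a] that by linarith
  have dst_to: "connected_to P (dst P a i) s" if "i \<in> J" for i
  proof -
    have "dst_count P a J (dst P a i) > 0"
      unfolding dst_count_def using fJ that by (auto simp: card_gt_0_iff)
    then show ?thesis using step.prems(4) x by simp
  qed
  have zq: "z t \<le> q t" for t using le unfolding z_def by simp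
  have from_init: "connected_to P (init P) t" if "z t > 0" for t
    using supp_reachable[OF step.hyps(1), of t] zq[of t] that by linarith
  have z_recv: "z r > 0" if "y r > 0" for r using that unfolding z_def by simp
  have z_src: "z (src P a i) > 0" if "i \<in> J" for i
    unfolding z_def src_count_def using fJ that by (auto simp: card_gt_0_iff)
  have z_to: "connected_to P t s" if pos: "z t > 0" for t
  proof -
    consider "y t > 0" | "src_count P a J t > 0" using pos unfolding z_def by linarith
    then show ?thesis
    proof cases
      case 1
      then show ?thesis
        using connected_to_trans connected_to_step recv_trans[OF a ystates] recv_to by metis
    next
      case 2
      obtain i where i: "i \<in> J" "src P a i = t"
        using card_fibre_posD[OF 2[unfolded src_count_def]] by blast
      have "connected_to P t (dst P a i)"
        using connected_to_step[OF send_trans[OF a, of i]] i J by blast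
      then show ?thesis by (rule connected_to_trans[OF _ dst_to[OF i(1)]])
    qed
  qed
  \<comment> \<open>No followed process is gained or lost: receiving preserves sums, and sources and
    destinations of \<open>J\<close> both count \<open>card J\<close>.\<close>
  have "sum (recv_map P a y) (states P) = sum y (states P)" by (rule sum_recv_map[OF a])
  moreover have "sum (dst_count P a J) (states P) = card J"
    unfolding dst_count_def using J dst_states[OF a] finite_states fJ
    by (intro sum_card_fibres) auto
  moreover have "sum (src_count P a J) (states P) = card J"
    unfolding src_count_def using J src_states[OF a] finite_states fJ
    by (intro sum_card_fibres) auto
  ultimately have sz: "sum z (states P) = m"
    using step.prems(2) unfolding z_def x by (simp add: sum.distrib)
  have "(global_step P)\<^sup>*\<^sup>* (init_global P m) z"
    using step.IH[OF zq sz step.prems(3) z_to] .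
  moreover have "global_step P z x"
  proof (rule free_sub_configuration_steps[OF a J _ z_def])
    show "x = (\<lambda>t. recv_map P a y t + dst_count P a J t)" using x by blast
    have "supp z \<subseteq> supp q" unfolding supp_def using zq by (auto intro: less_le_trans)
    then show "supp z \<subseteq> guard P a" using fires_decompose[OF f] by blast
    show "sum z (states P) > 0" using sz step.prems(3) by simp
    \<comment> \<open>Occupied states of \<open>q\<close> are reachable from \<open>init P\<close>,
      and the target of the transition is occupied in \<open>x\<close>, hence leads on to
      \<open>s\<close>.\<close>
    show "free_trans P (r, Recv a, guard P a, recv P a r)" if "y r > 0" for r
      using trans_on_free_path[OF free] from_init z_recv recv_to recv_trans[OF a ystates] that
      by blast
    show "free_trans P (src P a i, Send a i, guard P a, dst P a i)" if "i \<in> J" for i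
      using trans_on_free_path[OF free] from_init z_src dst_to send_trans[OF a] that J
      by blast
  qed (use y in blast)
  ultimately show ?case by simp
qed

end

theorem lemma2:
  fixes P :: "('s, 'a) gsp" and s :: 's
  assumes "gsp_process P"
    and "well_behaved P"
    and "s \<in> states P"
    and "\<And>\<tau>s. is_path P (init P) \<tau>s s \<Longrightarrow> free_path P \<tau>s"
  shows "synchronization_independent P s"
proof -
  have "sat_phi P m m s" if "sat_phi P n m s" for n m
  \<comment> \<open>The replay needs a followed process in every step; for \<open>m = 0\<close> the
    initial state already satisfies the bound.\<close>
  proof (cases "m = 0")
    case True
    then show ?thesis unfolding sat_phi_def by blast
  next
    case False
    obtain q where q: "(global_step P)\<^sup>*\<^sup>* (init_global P n) q" "m \<le> q s"
      using \<open>sat_phi P n m s\<close> unfolding sat_phi_def by blast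
    \<comment> \<open>Exactly \<open>m\<close> of the processes that \<open>q\<close> has in
      \<open>s\<close> are followed; the path from \<open>s\<close> to \<open>s\<close> is the empty
      one.\<close>
    define x where "x = (\<lambda>t. if t = s then m else 0)"
    have "(global_step P)\<^sup>*\<^sup>* (init_global P m) x"
    proof (rule sub_configuration_reachable[OF assms(1) assms(4) q(1)])
      show "x t \<le> q t" for t using q(2) unfolding x_def by simp
      show "sum x (states P) = m"
        unfolding x_def using finite_states[OF assms(1)] assms(3) by simp
      show "connected_to P t s" if "x t > 0" for t
        using that connected_to_refl unfolding x_def by (metis less_numeral_extra(3))
    qed (use False in auto)
    moreover have "m \<le> x s" unfolding x_def by simp
    ultimately show ?thesis unfolding sat_phi_def by blast
  qed
  then show ?thesis unfolding synchronization_independent_def is_cutoff_def by blast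
qed

end
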